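(* Suppose $\vdash\varphi$ and ${\sf reduce}({\cal L},\varphi)=\psi$ for a partial structure ${\cal L}$. Then ${\tt atoms}({\cal L},\psi)\subseteq{\tt atoms}({\cal L},\varphi)\cap\{P\mid\rho_{\cal L}(P)={\tt uu}\}$.
   Context: Atoms are $p(t_1,\ldots,t_n)$ ($p$ objective or subjective), plus special objective atoms $\vec t\not\in S$ ($S$ a finite set of tuples of ground terms). Restrictions: $c ::= p_O(t_1,\ldots,t_n)\mid\vec x\not\in S\mid\top\mid\bot\mid c_1\wedge c_2\mid c_1\vee c_2\mid\exists x.c$ ($p_O$ objective). Formulas: $\varphi ::= P\mid\top\mid\bot\mid\varphi_1\wedge\varphi_2\mid\varphi_1\vee\varphi_2\mid\forall\vec x.(c\supset\varphi)\mid\exists\vec x.(c\wedge\varphi)$. A partial structure ${\cal L}$ is a total function $\rho_{\cal L}$ from ground atoms to $\{{\tt tt},{\tt ff},{\tt uu}\}$ (with $\rho_{\cal L}(\vec t\not\in S)={\tt tt}$ iff $\vec t\notin S$, else ${\tt ff}$); ${\cal L}\models P$ iff $\rho_{\cal L}(P)={\tt tt}$. Substitutions map finitely many variables to ground terms; $\bullet$ is the empty one; $\sigma'\geq\sigma$ means $\sigma'$ extends $\sigma$; $\sigma_1+\sigma_2$ is union; $\sigma\backslash\{x\}$ removes $x$. Each objective predicate $p_O$ has input positions $I(p_O)$ and output positions $O(p_O)$ (all positions of $\vec x\not\in S$ are input). A function ${\tt sat}$ is given: for each ${\cal L}$ and objective atom $P=p_O(t_1,\ldots,t_n)$ with $t_k$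 ground for all $k\in I(p_O)$, ${\tt sat}({\cal L},P)$ is a finite set of substitutions, each with domain containing $\bigcup_{j\in O(p_O)}\mathrm{fv}(t_j)$, such that for all $\sigma'$ with $\mathrm{dom}(\sigma')\supseteq\mathrm{fv}(P)$, ${\cal L}\models P\sigma'$ iff $\sigma'\geq\sigma$ for some $\sigma\in{\tt sat}({\cal L},P)$; undefined otherwise (for ground $\vec t$, ${\tt sat}({\cal L},\vec t\not\in S)=\{\bullet\}$ if $\vec t\notin S$, else $\{\}$). $\widehat{{\tt sat}}$: $\widehat{{\tt sat}}({\cal L},p_O(\vec t))={\tt sat}({\cal L},p_O(\vec t))$; $\widehat{{\tt sat}}({\cal L},\top)=\{\bullet\}$; $\widehat{{\tt sat}}({\cal L},\bot)=\{\}$; $\widehat{{\tt sat}}({\cal L},c_1\wedge c_2)=\bigcup_{\sigma_1\in\widehat{{\tt sat}}({\cal L},c_1)}\{\sigma_1+\sigma_2:\sigma_2\in\widehat{{\tt sat}}({\cal L},c_2\sigma_1)\}$; $\widehat{{\tt sat}}({\cal L},c_1\vee c_2)=\widehat{{\tt sat}}({\cal L},c_1)\cup\widehat{{\tt sat}}({\cal L},c_2)$; $\widehat{{\tt sat}}({\cal L},\exists x.c)=\{\sigma\backslash\{x\}:\sigma\in\widehat{{\tt sat}}({\cal L},c)\}$; defined only when all constituent calls are. ${\sf reduce}$ (partial): for a ground atom $P$, ${\sf reduce}({\cal L},P)$ is $\top$, $\bot$, $P$ according as $\rho_{\cal L}(P)$ is ${\tt tt}$, ${\tt ff}$, ${\tt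 uu}$; ${\sf reduce}({\cal L},\top)=\top$, ${\sf reduce}({\cal L},\bot)=\bot$; it commutes with $\wedge,\vee$. For $\forall\vec x.(c\supset\varphi')$: let $\{\sigma_1,\ldots,\sigma_n\}=\widehat{{\tt sat}}({\cal L},c)$, $\vec t_i=\sigma_i(\vec x)$, $S=\{\vec t_1,\ldots,\vec t_n\}$, $\psi_i={\sf reduce}({\cal L},\varphi'[\vec t_i/\vec x])$; result $\psi_1\wedge\cdots\wedge\psi_n\wedge\forall\vec x.((c\wedge\vec x\not\in S)\supset\varphi')$. For $\exists\vec x.(c\wedge\varphi')$: result $\psi_1\vee\cdots\vee\psi_n\vee\exists\vec x.((c\wedge\vec x\not\in S)\wedge\varphi')$. ${\tt atoms}$: ${\tt atoms}({\cal L},P)=\{P\}$; ${\tt atoms}({\cal L},\top)={\tt atoms}({\cal L},\bot)=\{\}$; ${\tt atoms}({\cal L},\varphi_1\wedge\varphi_2)={\tt atoms}({\cal L},\varphi_1\vee\varphi_2)={\tt atoms}({\cal L},\varphi_1)\cup{\tt atoms}({\cal L},\varphi_2)$; ${\tt atoms}({\cal L},\forall\vec x.(c\supset\varphi'))={\tt atoms}({\cal L},\exists\vec x.(c\wedge\varphi'))=\bigcup_{\sigma\in\widehat{{\tt sat}}({\cal L},c)}{\tt atoms}({\cal L},\varphi'\sigma)$. Mode judgments: for restrictions, $\chi_I\vdash p_O(t_1,\ldots,t_n):\chi_I\cup\bigcup_{j\in O(p_O)}\mathrm{fv}(t_j)$ provided $\mathrm{fv}(t_k)\subseteq\chi_I$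 for all $k\in I(p_O)$; $\chi_I\vdash\top:\chi_I$; $\chi_I\vdash\bot:\chi_I$; if $\chi_I\vdash c_1:\chi$ and $\chi\vdash c_2:\chi_O$ then $\chi_I\vdash c_1\wedge c_2:\chi_O$; if $\chi_I\vdash c_1:\chi_1$ and $\chi_I\vdash c_2:\chi_2$ then $\chi_I\vdash c_1\vee c_2:\chi_1\cap\chi_2$; if $\chi_I\vdash c:\chi_O$ then $\chi_I\vdash\exists x.c:\chi_O\backslash\{x\}$. For formulas, $\chi\vdash p(t_1,\ldots,t_n)$ if $\mathrm{fv}(t_k)\subseteq\chi$ for all $k$; $\chi\vdash\top$; $\chi\vdash\bot$; $\chi\vdash\varphi_1\wedge\varphi_2$ and $\chi\vdash\varphi_1\vee\varphi_2$ if $\chi\vdash\varphi_1$ and $\chi\vdash\varphi_2$; $\chi\vdash\forall\vec x.(c\supset\varphi)$ and $\chi\vdash\exists\vec x.(c\wedge\varphi)$ if there is $\chi_O$ with $\chi\vdash c:\chi_O$, $\vec x\subseteq\chi_O$, $\mathrm{fv}(c)\subseteq\chi\cup\vec x$, and $\chi_O\vdash\varphi$ (with $\vec x$ fresh). $\vdash\varphi$ means $\emptyset\vdash\varphi$. *)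

theory Defs
  imports "HOL-Library.Finite_Map"
begin

section \<open>Terms, atoms and partial structures\<close>

datatype 'f gterm = GFun 'f "'f gterm list"

datatype ('f, 'v) trm = Var 'v | Fun 'f "('f, 'v) trm list"

primrec of_gterm :: "'f gterm \<Rightarrow> ('f, 'v) trm" where
  "of_gterm (GFun f gs) = Fun f (map of_gterm gs)"

primrec fv_trm :: "('f, 'v) trm \<Rightarrow> 'v set" where
  "fv_trm (Var x) = {x}"
| "fv_trm (Fun f ts) = \<Union> (set (map fv_trm ts))"

definition fv_trms :: "('f, 'v) trm list \<Rightarrow> 'v set" where
  "fv_trms ts = \<Union> (fv_trm ` set ts)"

datatype ('o, 's) pred = Obj 'o | Subj 's

text \<open>Atoms over terms of type \<open>'t\<close>: general terms, or ground terms for ground atoms.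
  \<open>NotIn ts S\<close> is the special objective atom \<open>ts \<notin> S\<close>, where \<open>S\<close> always
  consists of tuples of ground terms.\<close>

datatype ('o, 's, 'f, 't) atom =
    Pred "('o, 's) pred" "'t list"
  | NotIn "'t list" "'f gterm list fset"

type_synonym ('o, 's, 'f, 'v) fo_atom = "('o, 's, 'f, ('f, 'v) trm) atom"
type_synonym ('o, 's, 'f) gatom = "('o, 's, 'f, 'f gterm) atom"

fun of_gatom :: "('o, 's, 'f) gatom \<Rightarrow> ('o, 's, 'f, 'v) fo_atom" where
  "of_gatom (Pred p gs) = Pred p (map of_gterm gs)"
| "of_gatom (NotIn gs S) = NotIn (map of_gterm gs) S"

fun fv_atom :: "('o, 's, 'f, 'v) fo_atom \<Rightarrow> 'v set" where
  "fv_atom (Pred p ts) = fv_trms ts"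
| "fv_atom (NotIn ts S) = fv_trms ts"

datatype tv = TT | FF | UU

text \<open>A partial structure is given by its values on ordinary ground atoms; its values on
  the atoms \<open>ts \<notin> S\<close> are forced, so \<open>rho L\<close> is the total function on all ground
  atoms.\<close>

type_synonym ('o, 's, 'f) pstruct = "('o, 's) pred \<Rightarrow> 'f gterm list \<Rightarrow> tv"

fun rho :: "('o, 's, 'f) pstruct \<Rightarrow> ('o, 's, 'f) gatom \<Rightarrow> tv" where
  "rho L (Pred p gs) = L p gs"
| "rho L (NotIn gs S) = (if gs |\<notin>| S then TT else FF)"

definition models :: "('o, 's, 'f) pstruct \<Rightarrow> ('o, 's, 'f, 'v) fo_atom \<Rightarrow> bool" where
  "models L P \<longleftrightarrow> (\<exists>G. P = of_gatom G \<and> rho L G = TT)"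


section \<open>Restrictions and formulas\<close>

text \<open>In \<open>RNotIn ts S\<close> the tuple may contain arbitrary terms rather than just variables, so
  that restrictions are closed under substitution.\<close>

datatype ('o, 'f, 'v) restriction =
    RPred 'o "('f, 'v) trm list"
  | RNotIn "('f, 'v) trm list" "'f gterm list fset"
  | RTop
  | RBot
  | RAnd "('o, 'f, 'v) restriction" "('o, 'f, 'v) restriction"
  | ROr "('o, 'f, 'v) restriction" "('o, 'f, 'v) restriction"
  | REx 'v "('o, 'f, 'v) restriction"

text \<open>\<open>All xs c \<phi>\<close> is \<open>\<forall>xs. (c \<supset> \<phi>)\<close> and \<open>Ex xs c \<phi>\<close> is
  \<open>\<exists>xs. (c \<and> \<phi>)\<close>.\<close>

datatype ('o, 's, 'f, 'v) formula =
    Atom "('o, 's, 'f, 'v) fo_atom"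
  | Top
  | Bot
  | And "('o, 's, 'f, 'v) formula" "('o, 's, 'f, 'v) formula"
  | Or "('o, 's, 'f, 'v) formula" "('o, 's, 'f, 'v) formula"
  | All "'v list" "('o, 'f, 'v) restriction" "('o, 's, 'f, 'v) formula"
  | Ex "'v list" "('o, 'f, 'v) restriction" "('o, 's, 'f, 'v) formula"

primrec fv_restr :: "('o, 'f, 'v) restriction \<Rightarrow> 'v set" where
  "fv_restr (RPred p ts) = fv_trms ts"
| "fv_restr (RNotIn ts S) = fv_trms ts"
| "fv_restr RTop = {}"
| "fv_restr RBot = {}"
| "fv_restr (RAnd c1 c2) = fv_restr c1 \<union> fv_restr c2"
| "fv_restr (ROr c1 c2) = fv_restr c1 \<union> fv_restr c2"
| "fv_restr (REx x c) = fv_restr c - {x}"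


section \<open>Substitutions\<close>

text \<open>Substituted terms are ground, so no capture can occur and it suffices to drop bound
  variables from the substitution.\<close>

type_synonym ('f, 'v) subst = "('v, 'f gterm) fmap"

primrec subst_trm :: "('f, 'v) subst \<Rightarrow> ('f, 'v) trm \<Rightarrow> ('f, 'v) trm" where
  "subst_trm \<sigma> (Var x) = (case fmlookup \<sigma> x of None \<Rightarrow> Var x | Some g \<Rightarrow> of_gterm g)"
| "subst_trm \<sigma> (Fun f ts) = Fun f (map (subst_trm \<sigma>) ts)"

fun subst_atom :: "('f, 'v) subst \<Rightarrow> ('o, 's, 'f, 'v) fo_atom \<Rightarrow> ('o, 's, 'f, 'v) fo_atom" where
  "subst_atom \<sigma> (Pred p ts) = Pred p (map (subst_trm \<sigma>) ts)"
| "subst_atom \<sigma> (NotIn ts S) = NotIn (map (subst_trm \<sigma>) ts) S"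

primrec subst_restr ::
    "('f, 'v) subst \<Rightarrow> ('o, 'f, 'v) restriction \<Rightarrow> ('o, 'f, 'v) restriction" where
  "subst_restr \<sigma> (RPred p ts) = RPred p (map (subst_trm \<sigma>) ts)"
| "subst_restr \<sigma> (RNotIn ts S) = RNotIn (map (subst_trm \<sigma>) ts) S"
| "subst_restr \<sigma> RTop = RTop"
| "subst_restr \<sigma> RBot = RBot"
| "subst_restr \<sigma> (RAnd c1 c2) = RAnd (subst_restr \<sigma> c1) (subst_restr \<sigma> c2)"
| "subst_restr \<sigma> (ROr c1 c2) = ROr (subst_restr \<sigma> c1) (subst_restr \<sigma> c2)"
| "subst_restr \<sigma> (REx x c) = REx x (subst_restr (fmdrop x \<sigma>) c)"

primrec subst_fm ::
    "('f, 'v) subst \<Rightarrow> ('o, 's, 'f, 'v) formula \<Rightarrow> ('o, 's, 'f, 'v) formula" where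
  "subst_fm \<sigma> (Atom P) = Atom (subst_atom \<sigma> P)"
| "subst_fm \<sigma> Top = Top"
| "subst_fm \<sigma> Bot = Bot"
| "subst_fm \<sigma> (And \<phi>1 \<phi>2) = And (subst_fm \<sigma> \<phi>1) (subst_fm \<sigma> \<phi>2)"
| "subst_fm \<sigma> (Or \<phi>1 \<phi>2) = Or (subst_fm \<sigma> \<phi>1) (subst_fm \<sigma> \<phi>2)"
| "subst_fm \<sigma> (All xs c \<phi>) =
    All xs (subst_restr (fmdrop_set (set xs) \<sigma>) c) (subst_fm (fmdrop_set (set xs) \<sigma>) \<phi>)"
| "subst_fm \<sigma> (Ex xs c \<phi>) =
    Ex xs (subst_restr (fmdrop_set (set xs) \<sigma>) c) (subst_fm (fmdrop_set (set xs) \<sigma>) \<phi>)"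


section \<open>The functions \<open>sat\<close> and its lifting to restrictions\<close>

text \<open>\<open>None\<close> represents undefinedness. Positions are counted from \<open>0\<close>; \<open>inp p\<close> and
  \<open>out p\<close> are the input and output positions of the objective predicate \<open>p\<close>.\<close>

type_synonym ('o, 's, 'f, 'v) sat_fun =
  "('o, 's, 'f) pstruct \<Rightarrow> 'o \<Rightarrow> ('f, 'v) trm list \<Rightarrow> ('f, 'v) subst set option"

definition inputs_ground :: "('o \<Rightarrow> nat set) \<Rightarrow> 'o \<Rightarrow> ('f, 'v) trm list \<Rightarrow> bool" where
  "inputs_ground inp p ts \<longleftrightarrow> (\<forall>k<length ts. k \<in> inp p \<longrightarrow> fv_trm (ts ! k) = {})"

definition out_vars :: "('o \<Rightarrow> nat set) \<Rightarrow> 'o \<Rightarrow> ('f, 'v) trm list \<Rightarrow> 'v set" where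
  "out_vars out p ts = (\<Union>j\<in>{j. j < length ts \<and> j \<in> out p}. fv_trm (ts ! j))"

text \<open>The specification is relative to one structure: requiring it for all functions of type
  \<open>pstruct\<close> at once would be unsatisfiable in general, because in some of them an atom with
  output variables has infinitely many true instances.\<close>

definition sat_spec ::
    "('o \<Rightarrow> nat set) \<Rightarrow> ('o \<Rightarrow> nat set) \<Rightarrow> ('o, 's, 'f, 'v) sat_fun \<Rightarrow> ('o, 's, 'f) pstruct \<Rightarrow> bool"
  where
  "sat_spec inp out sat L \<longleftrightarrow> (\<forall>p ts.
    (inputs_ground inp p ts \<longrightarrow> (\<exists>\<Sigma>. sat L p ts = Some \<Sigma> \<and> finite \<Sigma> \<and>
       (\<forall>\<sigma>\<in>\<Sigma>. out_vars out p ts \<subseteq> fmdom' \<sigma>) \<and>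
       (\<forall>\<sigma>'. fv_trms ts \<subseteq> fmdom' \<sigma>' \<longrightarrow>
          (models L (subst_atom \<sigma>' (Pred (Obj p) ts)) \<longleftrightarrow> (\<exists>\<sigma>\<in>\<Sigma>. \<sigma> \<subseteq>\<^sub>f \<sigma>'))))) \<and>
    (\<not> inputs_ground inp p ts \<longrightarrow> sat L p ts = None))"

text \<open>Union of a family of partially defined sets, defined iff all members are.\<close>

definition UN_option :: "'a set \<Rightarrow> ('a \<Rightarrow> 'b set option) \<Rightarrow> 'b set option" where
  "UN_option A F = (if \<exists>a\<in>A. F a = None then None else Some (\<Union>a\<in>A. the (F a)))"

lemma UN_option_cong [fundef_cong]:
  "A = B \<Longrightarrow> (\<And>a. a \<in> B \<Longrightarrow> F a = G a) \<Longrightarrow> UN_option A F = UN_option B G"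
  unfolding UN_option_def by auto

definition Un_option :: "'b set option \<Rightarrow> 'b set option \<Rightarrow> 'b set option" where
  "Un_option X Y = (case (X, Y) of (Some A, Some B) \<Rightarrow> Some (A \<union> B) | _ \<Rightarrow> None)"

primrec size_restr :: "('o, 'f, 'v) restriction \<Rightarrow> nat" where
  "size_restr (RPred p ts) = 1"
| "size_restr (RNotIn ts S) = 1"
| "size_restr RTop = 1"
| "size_restr RBot = 1"
| "size_restr (RAnd c1 c2) = Suc (size_restr c1 + size_restr c2)"
| "size_restr (ROr c1 c2) = Suc (size_restr c1 + size_restr c2)"
| "size_restr (REx x c) = Suc (size_restr c)"

lemma size_restr_subst [simp]: "size_restr (subst_restr \<sigma> c) = size_restr c"
  by (induction c arbitrary: \<sigma>) auto

text \<open>The sum \<open>\<sigma>1 + \<sigma>2\<close> of substitutions is map addition, which is the union whenever the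
  union is again a substitution.\<close>

function (sequential) hat_sat ::
    "('o, 's, 'f, 'v) sat_fun \<Rightarrow> ('o, 's, 'f) pstruct \<Rightarrow> ('o, 'f, 'v) restriction \<Rightarrow>
     ('f, 'v) subst set option" where
  "hat_sat sat L (RPred p ts) = sat L p ts"
| "hat_sat sat L (RNotIn ts S) =
    (if fv_trms ts \<noteq> {} then None
     else if ts \<in> map of_gterm ` fset S then Some {} else Some {fmempty})"
| "hat_sat sat L RTop = Some {fmempty}"
| "hat_sat sat L RBot = Some {}"
| "hat_sat sat L (RAnd c1 c2) =
    Option.bind (hat_sat sat L c1) (\<lambda>\<Sigma>1. UN_option \<Sigma>1 (\<lambda>\<sigma>1.
      map_option (\<lambda>\<Sigma>2. {\<sigma>1 ++\<^sub>f \<sigma>2 | \<sigma>2. \<sigma>2 \<in> \<Sigma>2}) (hat_sat sat L (subst_restr \<sigma>1 c2))))"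
| "hat_sat sat L (ROr c1 c2) = Un_option (hat_sat sat L c1) (hat_sat sat L c2)"
| "hat_sat sat L (REx x c) = map_option (\<lambda>\<Sigma>. {fmdrop x \<sigma> | \<sigma>. \<sigma> \<in> \<Sigma>}) (hat_sat sat L c)"
  by pat_completeness auto
termination
  by (relation "measure (\<lambda>(sat, L, c). size_restr c)") auto


section \<open>Atoms of a formula\<close>

primrec size_fm :: "('o, 's, 'f, 'v) formula \<Rightarrow> nat" where
  "size_fm (Atom P) = 1"
| "size_fm Top = 1"
| "size_fm Bot = 1"
| "size_fm (And \<phi>1 \<phi>2) = Suc (size_fm \<phi>1 + size_fm \<phi>2)"
| "size_fm (Or \<phi>1 \<phi>2) = Suc (size_fm \<phi>1 + size_fm \<phi>2)"
| "size_fm (All xs c \<phi>) = Suc (size_fm \<phi>)"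
| "size_fm (Ex xs c \<phi>) = Suc (size_fm \<phi>)"

lemma size_fm_subst [simp]: "size_fm (subst_fm \<sigma> \<phi>) = size_fm \<phi>"
  by (induction \<phi> arbitrary: \<sigma>) auto

function (sequential) atoms ::
    "('o, 's, 'f, 'v) sat_fun \<Rightarrow> ('o, 's, 'f) pstruct \<Rightarrow> ('o, 's, 'f, 'v) formula \<Rightarrow>
     ('o, 's, 'f, 'v) fo_atom set option" where
  "atoms sat L (Atom P) = Some {P}"
| "atoms sat L Top = Some {}"
| "atoms sat L Bot = Some {}"
| "atoms sat L (And \<phi>1 \<phi>2) = Un_option (atoms sat L \<phi>1) (atoms sat L \<phi>2)"
| "atoms sat L (Or \<phi>1 \<phi>2) = Un_option (atoms sat L \<phi>1) (atoms sat L \<phi>2)"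
| "atoms sat L (All xs c \<phi>) =
    Option.bind (hat_sat sat L c) (\<lambda>\<Sigma>. UN_option \<Sigma> (\<lambda>\<sigma>. atoms sat L (subst_fm \<sigma> \<phi>)))"
| "atoms sat L (Ex xs c \<phi>) =
    Option.bind (hat_sat sat L c) (\<lambda>\<Sigma>. UN_option \<Sigma> (\<lambda>\<sigma>. atoms sat L (subst_fm \<sigma> \<phi>)))"
  by pat_completeness auto
termination
  by (relation "measure (\<lambda>(sat, L, \<phi>). size_fm \<phi>)") auto


section \<open>The partial function \<open>reduce\<close>\<close>

text \<open>The order in which the elements of \<open>hat_sat sat L c\<close> are enumerated is not fixed, so
  \<open>reduce\<close> is a relation: \<open>reduces sat L \<phi> \<psi>\<close> holds iff \<open>\<psi>\<close> is the result of
  \<open>reduce(L, \<phi>)\<close> for some enumerations. Undefinedness is the absence of a result; in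
  particular every \<open>\<sigma>\<^sub>i\<close> has to be defined on all of \<open>xs\<close>.\<close>

inductive reduces ::
    "('o, 's, 'f, 'v) sat_fun \<Rightarrow> ('o, 's, 'f) pstruct \<Rightarrow> ('o, 's, 'f, 'v) formula \<Rightarrow>
     ('o, 's, 'f, 'v) formula \<Rightarrow> bool"
  for sat :: "('o, 's, 'f, 'v) sat_fun" and L :: "('o, 's, 'f) pstruct" where
  atom_tt: "rho L G = TT \<Longrightarrow> reduces sat L (Atom (of_gatom G)) Top"
| atom_ff: "rho L G = FF \<Longrightarrow> reduces sat L (Atom (of_gatom G)) Bot"
| atom_uu: "rho L G = UU \<Longrightarrow> reduces sat L (Atom (of_gatom G)) (Atom (of_gatom G))"
| top: "reduces sat L Top Top"
| bot: "reduces sat L Bot Bot"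
| conj: "reduces sat L \<phi>1 \<psi>1 \<Longrightarrow> reduces sat L \<phi>2 \<psi>2 \<Longrightarrow>
    reduces sat L (And \<phi>1 \<phi>2) (And \<psi>1 \<psi>2)"
| disj: "reduces sat L \<phi>1 \<psi>1 \<Longrightarrow> reduces sat L \<phi>2 \<psi>2 \<Longrightarrow>
    reduces sat L (Or \<phi>1 \<phi>2) (Or \<psi>1 \<psi>2)"
| all: "\<lbrakk>hat_sat sat L c = Some (set \<sigma>s); distinct \<sigma>s;
    list_all2 (\<lambda>\<sigma> t. map (fmlookup \<sigma>) xs = map Some t) \<sigma>s ts;
    list_all2 (\<lambda>t \<psi>. reduces sat L (subst_fm (fmap_of_list (zip xs t)) \<phi>) \<psi>) ts \<psi>s\<rbrakk> \<Longrightarrow>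
    reduces sat L (All xs c \<phi>)
      (foldr And \<psi>s (All xs (RAnd c (RNotIn (map Var xs) (fset_of_list ts))) \<phi>))"
| ex: "\<lbrakk>hat_sat sat L c = Some (set \<sigma>s); distinct \<sigma>s;
    list_all2 (\<lambda>\<sigma> t. map (fmlookup \<sigma>) xs = map Some t) \<sigma>s ts;
    list_all2 (\<lambda>t \<psi>. reduces sat L (subst_fm (fmap_of_list (zip xs t)) \<phi>) \<psi>) ts \<psi>s\<rbrakk> \<Longrightarrow>
    reduces sat L (Ex xs c \<phi>)
      (foldr Or \<psi>s (Ex xs (RAnd c (RNotIn (map Var xs) (fset_of_list ts))) \<phi>))"


section \<open>Mode judgments\<close>

inductive restr_mode ::
    "('o \<Rightarrow> nat set) \<Rightarrow> ('o \<Rightarrow> nat set) \<Rightarrow> 'v set \<Rightarrow> ('o, 'f, 'v) restriction \<Rightarrow> 'v set \<Rightarrow> bool"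
  for inp out :: "'o \<Rightarrow> nat set" where
  pred: "(\<And>k. k < length ts \<Longrightarrow> k \<in> inp p \<Longrightarrow> fv_trm (ts ! k) \<subseteq> \<chi>) \<Longrightarrow>
    restr_mode inp out \<chi> (RPred p ts) (\<chi> \<union> out_vars out p ts)"
| notin: "fv_trms ts \<subseteq> \<chi> \<Longrightarrow> restr_mode inp out \<chi> (RNotIn ts S) \<chi>"
| top: "restr_mode inp out \<chi> RTop \<chi>"
| bot: "restr_mode inp out \<chi> RBot \<chi>"
| conj: "restr_mode inp out \<chi>I c1 \<chi> \<Longrightarrow> restr_mode inp out \<chi> c2 \<chi>O \<Longrightarrow>
    restr_mode inp out \<chi>I (RAnd c1 c2) \<chi>O"
| disj: "restr_mode inp out \<chi>I c1 \<chi>1 \<Longrightarrow> restr_mode inp out \<chi>I c2 \<chi>2 \<Longrightarrow>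
    restr_mode inp out \<chi>I (ROr c1 c2) (\<chi>1 \<inter> \<chi>2)"
| ex: "restr_mode inp out \<chi>I c \<chi>O \<Longrightarrow> restr_mode inp out \<chi>I (REx x c) (\<chi>O - {x})"

text \<open>Freshness of the bound variables \<open>xs\<close> is the condition \<open>set xs \<inter> \<chi> = {}\<close>.\<close>

inductive fm_mode ::
    "('o \<Rightarrow> nat set) \<Rightarrow> ('o \<Rightarrow> nat set) \<Rightarrow> 'v set \<Rightarrow> ('o, 's, 'f, 'v) formula \<Rightarrow> bool"
  for inp out :: "'o \<Rightarrow> nat set" where
  atom: "fv_atom P \<subseteq> \<chi> \<Longrightarrow> fm_mode inp out \<chi> (Atom P)"
| top: "fm_mode inp out \<chi> Top"
| bot: "fm_mode inp out \<chi> Bot"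
| conj: "fm_mode inp out \<chi> \<phi>1 \<Longrightarrow> fm_mode inp out \<chi> \<phi>2 \<Longrightarrow> fm_mode inp out \<chi> (And \<phi>1 \<phi>2)"
| disj: "fm_mode inp out \<chi> \<phi>1 \<Longrightarrow> fm_mode inp out \<chi> \<phi>2 \<Longrightarrow> fm_mode inp out \<chi> (Or \<phi>1 \<phi>2)"
| all: "\<lbrakk>set xs \<inter> \<chi> = {}; restr_mode inp out \<chi> c \<chi>O; set xs \<subseteq> \<chi>O;
    fv_restr c \<subseteq> \<chi> \<union> set xs; fm_mode inp out \<chi>O \<phi>\<rbrakk> \<Longrightarrow> fm_mode inp out \<chi> (All xs c \<phi>)"
| ex: "\<lbrakk>set xs \<inter> \<chi> = {}; restr_mode inp out \<chi> c \<chi>O; set xs \<subseteq> \<chi>O;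
    fv_restr c \<subseteq> \<chi> \<union> set xs; fm_mode inp out \<chi>O \<phi>\<rbrakk> \<Longrightarrow> fm_mode inp out \<chi> (Ex xs c \<phi>)"

end

(* The mode judgment enters only through its consequence that formulas moded by the empty
   context are closed.  For closed \<forall>xs. (c \<supset> \<phi>), the instance \<phi>\<sigma> depends only on \<sigma>(xs), so
   atoms and reduce visit the same instances of \<phi>; and the restriction of the residual
   quantifier excludes every solution of c, so the residual has no atoms. *)

theory Submission
  imports Defs
begin

text \<open>Closedness, \<open>fv_fm \<phi> = {}\<close>, is the invariant that takes the place of
  the mode judgment in the induction over \<open>reduces\<close>.\<close>

primrec fv_fm :: "('o, 's, 'f, 'v) formula \<Rightarrow> 'v set" where
  "fv_fm (Atom P) = fv_atom P"
| "fv_fm Top = {}"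
| "fv_fm Bot = {}"
| "fv_fm (And \<phi>1 \<phi>2) = fv_fm \<phi>1 \<union> fv_fm \<phi>2"
| "fv_fm (Or \<phi>1 \<phi>2) = fv_fm \<phi>1 \<union> fv_fm \<phi>2"
| "fv_fm (All xs c \<phi>) = (fv_restr c \<union> fv_fm \<phi>) - set xs"
| "fv_fm (Ex xs c \<phi>) = (fv_restr c \<union> fv_fm \<phi>) - set xs"

lemma fv_of_gterm [simp]: "fv_trm (of_gterm g) = {}"
  by (induction g) auto

text \<open>Substituted terms are ground, so a substitution can only remove variables.\<close>

lemma fv_subst_trm: "fv_trm (subst_trm \<sigma> t) = fv_trm t - fmdom' \<sigma>"
  by (induction t) (auto simp: fmdom'_notI fmdom'I split: option.split)

lemma fv_subst_trms: "fv_trms (map (subst_trm \<sigma>) ts) = fv_trms ts - fmdom' \<sigma>"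
  by (auto simp: fv_trms_def fv_subst_trm)

lemma fv_subst_atom: "fv_atom (subst_atom \<sigma> P) = fv_atom P - fmdom' \<sigma>"
  by (cases P) (auto simp: fv_subst_trms)

lemma fv_subst_restr: "fv_restr (subst_restr \<sigma> c) = fv_restr c - fmdom' \<sigma>"
  by (induction c arbitrary: \<sigma>) (auto simp: fv_subst_trms)

lemma fv_subst_fm: "fv_fm (subst_fm \<sigma> \<phi>) = fv_fm \<phi> - fmdom' \<sigma>"
  by (induction \<phi> arbitrary: \<sigma>) (auto simp: fv_subst_atom fv_subst_restr)

lemma subst_trm_cong:
  "(\<And>x. x \<in> fv_trm t \<Longrightarrow> fmlookup \<sigma> x = fmlookup \<tau> x) \<Longrightarrow> subst_trm \<sigma> t = subst_trm \<tau> t"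
  by (induction t) auto

lemma subst_trms_cong:
  "(\<And>x. x \<in> fv_trms ts \<Longrightarrow> fmlookup \<sigma> x = fmlookup \<tau> x) \<Longrightarrow>
    map (subst_trm \<sigma>) ts = map (subst_trm \<tau>) ts"
  by (auto simp: fv_trms_def intro!: subst_trm_cong)

lemma subst_atom_cong:
  "(\<And>x. x \<in> fv_atom P \<Longrightarrow> fmlookup \<sigma> x = fmlookup \<tau> x) \<Longrightarrow> subst_atom \<sigma> P = subst_atom \<tau> P"
  by (cases P) (auto intro: subst_trms_cong simp del: map_eq_conv)

lemma subst_restr_cong:
  "(\<And>x. x \<in> fv_restr c \<Longrightarrow> fmlookup \<sigma> x = fmlookup \<tau> x) \<Longrightarrow> subst_restr \<sigma> c = subst_restr \<tau> c"
proof (induction c arbitrary: \<sigma> \<tau>)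
  case (RPred p ts)
  then show ?case using subst_trms_cong[of ts \<sigma> \<tau>] by simp
next
  case (RNotIn ts S)
  then show ?case using subst_trms_cong[of ts \<sigma> \<tau>] by simp
next
  case (RAnd c1 c2)
  have "subst_restr \<sigma> c1 = subst_restr \<tau> c1" by (rule RAnd.IH) (simp add: RAnd.prems)
  moreover have "subst_restr \<sigma> c2 = subst_restr \<tau> c2" by (rule RAnd.IH) (simp add: RAnd.prems)
  ultimately show ?case by simp
next
  case (ROr c1 c2)
  have "subst_restr \<sigma> c1 = subst_restr \<tau> c1" by (rule ROr.IH) (simp add: ROr.prems)
  moreover have "subst_restr \<sigma> c2 = subst_restr \<tau> c2" by (rule ROr.IH) (simp add: ROr.prems)
  ultimately show ?case by simp
next
  case (REx x c)
  have "subst_restr (fmdrop x \<sigma>) c = subst_restr (fmdrop x \<tau>) c"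
    by (rule REx.IH) (simp add: REx.prems)
  then show ?case by simp
qed simp_all

text \<open>Below a quantifier both substitutions have lost the bound variables, hence agree there
  as undefined; on the other variables of the body they agree by assumption.\<close>

lemma subst_fm_cong:
  "(\<And>x. x \<in> fv_fm \<phi> \<Longrightarrow> fmlookup \<sigma> x = fmlookup \<tau> x) \<Longrightarrow> subst_fm \<sigma> \<phi> = subst_fm \<tau> \<phi>"
proof (induction \<phi> arbitrary: \<sigma> \<tau>)
  case (Atom P)
  then show ?case using subst_atom_cong[of P \<sigma> \<tau>] by simp
next
  case (And \<phi>1 \<phi>2)
  have "subst_fm \<sigma> \<phi>1 = subst_fm \<tau> \<phi>1" by (rule And.IH) (simp add: And.prems)
  moreover have "subst_fm \<sigma> \<phi>2 = subst_fm \<tau> \<phi>2" by (rule And.IH) (simp add: And.prems)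
  ultimately show ?case by simp
next
  case (Or \<phi>1 \<phi>2)
  have "subst_fm \<sigma> \<phi>1 = subst_fm \<tau> \<phi>1" by (rule Or.IH) (simp add: Or.prems)
  moreover have "subst_fm \<sigma> \<phi>2 = subst_fm \<tau> \<phi>2" by (rule Or.IH) (simp add: Or.prems)
  ultimately show ?case by simp
next
  case (All xs c \<phi>)
  have "subst_fm (fmdrop_set (set xs) \<sigma>) \<phi> = subst_fm (fmdrop_set (set xs) \<tau>) \<phi>"
    by (rule All.IH) (simp add: All.prems)
  moreover have "subst_restr (fmdrop_set (set xs) \<sigma>) c = subst_restr (fmdrop_set (set xs) \<tau>) c"
    by (rule subst_restr_cong) (simp add: All.prems)
  ultimately show ?case by simp
next
  case (Ex xs c \<phi>)
  have "subst_fm (fmdrop_set (set xs) \<sigma>) \<phi> = subst_fm (fmdrop_set (set xs) \<tau>) \<phi>"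
    by (rule Ex.IH) (simp add: Ex.prems)
  moreover have "subst_restr (fmdrop_set (set xs) \<sigma>) c = subst_restr (fmdrop_set (set xs) \<tau>) c"
    by (rule subst_restr_cong) (simp add: Ex.prems)
  ultimately show ?case by simp
qed simp_all

lemma out_vars_subset: "out_vars out p ts \<subseteq> fv_trms ts"
  unfolding out_vars_def fv_trms_def using nth_mem by fast

text \<open>Only output positions enlarge the context, and the variables found there occur in the
  restriction. An existential removes its variable from the context and from the free variables
  alike.\<close>

lemma restr_mode_outputs:
  "restr_mode inp out \<chi> c \<chi>' \<Longrightarrow> \<chi>' \<subseteq> \<chi> \<union> fv_restr c"
proof (induction rule: restr_mode.induct)
  case (pred ts p \<chi>)
  then show ?case using out_vars_subset[of out p ts] by auto
qed auto

text \<open>The body of a quantifier is moded by a context within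
  \<open>\<chi> \<union> fv_restr c\<close>, which the side condition on \<open>fv_restr c\<close>
  puts within \<open>\<chi> \<union> set xs\<close>; binding \<open>xs\<close> leaves
  \<open>\<chi>\<close>.\<close>

lemma fm_mode_fv: "fm_mode inp out \<chi> \<phi> \<Longrightarrow> fv_fm \<phi> \<subseteq> \<chi>"
  by (induction rule: fm_mode.induct) (auto dest!: restr_mode_outputs)

text \<open>If a variable is repeated in \<open>xs\<close>, all its occurrences are paired with the
  same value, the one given by \<open>\<sigma>\<close>.\<close>

lemma fmlookup_zip:
  assumes "map (fmlookup \<sigma>) xs = map Some t" "x \<in> set xs"
  shows "fmlookup (fmap_of_list (zip xs t)) x = fmlookup \<sigma> x"
  using assms by (induction xs arbitrary: t) (auto simp: fmlookup_of_list Cons_eq_map_conv)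

lemma subst_trms_vars:
  "map (fmlookup \<sigma>) xs = map Some t \<Longrightarrow> map (subst_trm \<sigma>) (map Var xs) = map of_gterm t"
  by (induction xs arbitrary: t) (auto simp: Cons_eq_map_conv)

text \<open>The bridge between the two recursions: \<open>reduces\<close> instantiates a body with a
  tuple, \<open>atoms\<close> with the whole of \<open>\<sigma>\<close>, which may bind further
  variables.\<close>

lemma subst_fm_tuple:
  assumes "map (fmlookup \<sigma>) xs = map Some t" "fv_fm \<phi> \<subseteq> set xs"
  shows "subst_fm (fmap_of_list (zip xs t)) \<phi> = subst_fm \<sigma> \<phi>"
  using assms by (intro subst_fm_cong fmlookup_zip) auto

lemma closed_subst_fm_tuple:
  assumes "length t = length xs" "fv_fm \<phi> \<subseteq> set xs"
  shows "fv_fm (subst_fm (fmap_of_list (zip xs t)) \<phi>) = {}"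
  using assms by (auto simp: fv_subst_fm fmdom'_alt_def fset_of_list.rep_eq)

lemma UN_option_cover:
  assumes "\<And>a. a \<in> A \<Longrightarrow> \<exists>B. F a = Some B"
  obtains C where "UN_option A F = Some C" "\<And>a B. a \<in> A \<Longrightarrow> F a = Some B \<Longrightarrow> B \<subseteq> C"
proof
  show "UN_option A F = Some (\<Union>a\<in>A. the (F a))"
    using assms by (auto simp: UN_option_def)
qed force

text \<open>A solution of \<open>c\<close> sends \<open>xs\<close> to one of the recorded tuples, so
  it makes the added exclusion false, and no solution of the conjunction is left.\<close>

lemma hat_sat_residual:
  assumes "hat_sat sat L c = Some (set \<sigma>s)"
    and "list_all2 (\<lambda>\<sigma> t. map (fmlookup \<sigma>) xs = map Some t) \<sigma>s ts"
  shows "hat_sat sat L (RAnd c (RNotIn (map Var xs) (fset_of_list ts))) = Some {}"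
proof -
  have "hat_sat sat L (subst_restr \<sigma> (RNotIn (map Var xs) (fset_of_list ts))) = Some {}"
    if "\<sigma> \<in> set \<sigma>s" for \<sigma>
  proof -
    obtain i where i: "i < length \<sigma>s" "\<sigma> = \<sigma>s ! i"
      using \<open>\<sigma> \<in> set \<sigma>s\<close> by (metis in_set_conv_nth)
    define t where "t = ts ! i"
    have t: "t \<in> set ts" "map (fmlookup \<sigma>) xs = map Some t"
      using list_all2_nthD[OF assms(2) i(1)] list_all2_lengthD[OF assms(2)] i
      by (auto simp: t_def simp del: map_eq_conv)
    have "map (subst_trm \<sigma>) (map Var xs) = map of_gterm t"
      using t(2) by (rule subst_trms_vars)
    \<comment> \<open>Groundness makes \<open>hat_sat\<close> defined on the exclusion; otherwise
      its value would be \<open>None\<close> instead of \<open>Some {}\<close>.\<close>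
    moreover have "fv_trms (map of_gterm t) = {}"
      by (auto simp: fv_trms_def)
    ultimately show ?thesis
      using t(1) by (simp add: fset_of_list.rep_eq del: map_map)
  qed
  then show ?thesis
    using assms(1) by (simp add: UN_option_def del: map_map subst_restr.simps(2))
qed

text \<open>One bound \<open>C\<close> for all members survives the unions formed along the fold,
  and the residual at its end adds nothing.\<close>

lemma atoms_foldr_And:
  assumes "\<And>\<psi>. \<psi> \<in> set \<psi>s \<Longrightarrow> \<exists>A. atoms sat L \<psi> = Some A \<and> A \<subseteq> C" "atoms sat L \<chi> = Some {}"
  shows "\<exists>A. atoms sat L (foldr And \<psi>s \<chi>) = Some A \<and> A \<subseteq> C"
  using assms
proof (induction \<psi>s)
  case (Cons \<psi> \<psi>s)
  from Cons.prems(1)[of \<psi>] obtain A where "atoms sat L \<psi> = Some A" "A \<subseteq> C" by auto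
  moreover from Cons obtain B where "atoms sat L (foldr And \<psi>s \<chi>) = Some B" "B \<subseteq> C" by auto
  ultimately show ?case by (auto simp: Un_option_def)
qed simp

lemma atoms_foldr_Or:
  assumes "\<And>\<psi>. \<psi> \<in> set \<psi>s \<Longrightarrow> \<exists>A. atoms sat L \<psi> = Some A \<and> A \<subseteq> C" "atoms sat L \<chi> = Some {}"
  shows "\<exists>A. atoms sat L (foldr Or \<psi>s \<chi>) = Some A \<and> A \<subseteq> C"
  using assms
proof (induction \<psi>s)
  case (Cons \<psi> \<psi>s)
  from Cons.prems(1)[of \<psi>] obtain A where "atoms sat L \<psi> = Some A" "A \<subseteq> C" by auto
  moreover from Cons obtain B where "atoms sat L (foldr Or \<psi>s \<chi>) = Some B" "B \<subseteq> C" by auto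
  ultimately show ?case by (auto simp: Un_option_def)
qed simp

text \<open>The common core of both quantifier cases. The premise \<open>red\<close> has the shape
  of the induction hypothesis for the instances, still conditional on their closedness, and
  \<open>C\<close> becomes the set of atoms of the quantified formula.\<close>

lemma atoms_instances:
  assumes sat: "list_all2 (\<lambda>\<sigma> t. map (fmlookup \<sigma>) xs = map Some t) \<sigma>s ts"
    and red: "list_all2 (\<lambda>t \<psi>. fv_fm (subst_fm (fmap_of_list (zip xs t)) \<phi>) = {} \<longrightarrow>
      (\<exists>A B. atoms sat L \<psi> = Some A \<and>
        atoms sat L (subst_fm (fmap_of_list (zip xs t)) \<phi>) = Some B \<and> A \<subseteq> B \<inter> U)) ts \<psi>s"
    and fv: "fv_fm \<phi> \<subseteq> set xs"
  obtains C where "UN_option (set \<sigma>s) (\<lambda>\<sigma>. atoms sat L (subst_fm \<sigma> \<phi>)) = Some C"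
    "\<And>\<psi>. \<psi> \<in> set \<psi>s \<Longrightarrow> \<exists>A. atoms sat L \<psi> = Some A \<and> A \<subseteq> C \<inter> U"
proof -
  have len: "length \<sigma>s = length ts" "length ts = length \<psi>s"
    using sat red by (auto dest: list_all2_lengthD)
  have inst: "\<exists>A B. atoms sat L (\<psi>s ! i) = Some A \<and>
      atoms sat L (subst_fm (\<sigma>s ! i) \<phi>) = Some B \<and> A \<subseteq> B \<inter> U" if i: "i < length \<sigma>s" for i
  proof -
    \<comment> \<open>Solution, tuple and reduct correspond by index. Closedness of the
      \<open>i\<close>-th instance discharges the condition in \<open>red\<close>, and its tuple
      substitution can then be replaced by \<open>\<sigma>s ! i\<close>.\<close>
    have m: "map (fmlookup (\<sigma>s ! i)) xs = map Some (ts ! i)"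
      using sat i by (simp add: list_all2_conv_all_nth)
    then have "length (ts ! i) = length xs"
      by (metis length_map)
    then show ?thesis
      using list_all2_nthD[OF red, of i] i len closed_subst_fm_tuple[OF _ fv, of "ts ! i"]
        subst_fm_tuple[OF m fv] by simp
  qed
  have "\<exists>B. atoms sat L (subst_fm \<sigma> \<phi>) = Some B" if "\<sigma> \<in> set \<sigma>s" for \<sigma>
    using inst that by (metis in_set_conv_nth)
  then obtain C where C: "UN_option (set \<sigma>s) (\<lambda>\<sigma>. atoms sat L (subst_fm \<sigma> \<phi>)) = Some C"
    "\<And>\<sigma> B. \<sigma> \<in> set \<sigma>s \<Longrightarrow> atoms sat L (subst_fm \<sigma> \<phi>) = Some B \<Longrightarrow> B \<subseteq> C"
    using UN_option_cover[of "set \<sigma>s" "\<lambda>\<sigma>. atoms sat L (subst_fm \<sigma> \<phi>)"] by auto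
  have "\<exists>A. atoms sat L \<psi> = Some A \<and> A \<subseteq> C \<inter> U" if "\<psi> \<in> set \<psi>s" for \<psi>
  proof -
    obtain i where i: "i < length \<sigma>s" "\<psi> = \<psi>s ! i"
      using \<open>\<psi> \<in> set \<psi>s\<close> len by (metis in_set_conv_nth)
    then obtain A B where "atoms sat L \<psi> = Some A" "A \<subseteq> B \<inter> U"
      "atoms sat L (subst_fm (\<sigma>s ! i) \<phi>) = Some B"
      using inst by blast
    then show ?thesis
      using C(2)[of "\<sigma>s ! i" B] i by auto
  qed
  with C(1) that show thesis by blast
qed

text \<open>The induction follows \<open>reduces\<close>, since the instances reduced below a
  quantifier are not subformulas. Definedness of both atom sets is proved along with the inclusion,
  as one undefined member would make a whole union undefined.\<close>

lemma atoms_reduces_closed: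
  fixes \<phi> :: "('o, 's, 'f, 'v) formula"
  assumes "reduces sat L \<phi> \<psi>" "fv_fm \<phi> = {}"
  shows "\<exists>A B. atoms sat L \<psi> = Some A \<and> atoms sat L \<phi> = Some B \<and>
    A \<subseteq> B \<inter> {of_gatom P | P. rho L P = UU}"
  using assms
proof (induction rule: reduces.induct)
  case (conj \<phi>1 \<psi>1 \<phi>2 \<psi>2)
  then show ?case by (fastforce simp: Un_option_def)
next
  case (disj \<phi>1 \<psi>1 \<phi>2 \<psi>2)
  then show ?case by (fastforce simp: Un_option_def)
next
  case (all c \<sigma>s xs ts \<phi> \<psi>s)
  from all.prems have fv: "fv_fm \<phi> \<subseteq> set xs" by auto
  obtain C where C: "UN_option (set \<sigma>s) (\<lambda>\<sigma>. atoms sat L (subst_fm \<sigma> \<phi>)) = Some C"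
    "\<And>\<psi>. \<psi> \<in> set \<psi>s \<Longrightarrow>
      \<exists>A. atoms sat L \<psi> = Some A \<and> A \<subseteq> C \<inter> {of_gatom P | P. rho L P = UU}"
    \<comment> \<open>Monotonicity of \<open>list_all2\<close> extracts the conditional claim from
      the induction hypothesis, which pairs it with the reduction itself.\<close>
    by (rule atoms_instances[OF all.hyps(3) list_all2_mono[OF all.IH] fv]) blast+
  \<comment> \<open>With no solutions of its restriction, the residual contributes an empty union,
    whatever its body is.\<close>
  have "atoms sat L (All xs (RAnd c (RNotIn (map Var xs) (fset_of_list ts))) \<phi>) = Some {}"
    using hat_sat_residual[OF all.hyps(1,3)] by (simp add: UN_option_def del: hat_sat.simps)
  from atoms_foldr_And[OF C(2) this] C(1) all.hyps(1) show ?case by simp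
next
  case (ex c \<sigma>s xs ts \<phi> \<psi>s)
  from ex.prems have fv: "fv_fm \<phi> \<subseteq> set xs" by auto
  obtain C where C: "UN_option (set \<sigma>s) (\<lambda>\<sigma>. atoms sat L (subst_fm \<sigma> \<phi>)) = Some C"
    "\<And>\<psi>. \<psi> \<in> set \<psi>s \<Longrightarrow>
      \<exists>A. atoms sat L \<psi> = Some A \<and> A \<subseteq> C \<inter> {of_gatom P | P. rho L P = UU}"
    by (rule atoms_instances[OF ex.hyps(3) list_all2_mono[OF ex.IH] fv]) blast+
  have "atoms sat L (Ex xs (RAnd c (RNotIn (map Var xs) (fset_of_list ts))) \<phi>) = Some {}"
    using hat_sat_residual[OF ex.hyps(1,3)] by (simp add: UN_option_def del: hat_sat.simps)
  from atoms_foldr_Or[OF C(2) this] C(1) ex.hyps(1) show ?case by simp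
\<comment> \<open>Among the atom cases only the value \<open>UU\<close> leaves an atom behind, and
  the premise of that rule is its membership in the right-hand set.\<close>
qed auto

theorem mainTheorem12:
  fixes inp out :: "'o \<Rightarrow> nat set"
    and sat :: "('o, 's, 'f, 'v) sat_fun"
    and L :: "('o, 's, 'f) pstruct"
    and \<phi> \<psi> :: "('o, 's, 'f, 'v) formula"
  assumes "sat_spec inp out sat L"
    and "fm_mode inp out {} \<phi>"
    and "reduces sat L \<phi> \<psi>"
  shows "\<exists>A B. atoms sat L \<psi> = Some A \<and> atoms sat L \<phi> = Some B \<and>
    A \<subseteq> B \<inter> {of_gatom P | P. rho L P = UU}"
  using atoms_reduces_closed[OF assms(3)] fm_mode_fv[OF assms(2)] by blast

end
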